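(* For every integer $r\ge0$, all integers $m,n\ge0$ and all real $x,y$ with $1+\lambda x>0$, \[ B^{(r)}_{n+m,\lambda}(x,y)=\sum_{k=0}^{m}\sum_{l=0}^{n}\binom{n}{l}{m+r\brace k+r}_{r,\lambda}(k-m\lambda)_{n-l,\lambda}(y)_{k,\lambda}\,x^k\,B^{(r)}_{l,\lambda}(x,y-k\lambda), \] and \[ B^{(r)}_{n+m,\lambda}(x)=\sum_{k=0}^{m}\sum_{l=0}^{n}\binom{n}{l}{m+r\brace k+r}_{r,\lambda}(k-m\lambda)_{n-l,\lambda}(1)_{k,\lambda}\,x^k\,B^{(r)}_{l,\lambda}(x,1-k\lambda). \]
   Context: Let $\lambda$ be a fixed nonzero real number and $r\ge0$ an integer. The degenerate falling factorial is $(x)_{0,\lambda}=1$ and $(x)_{n,\lambda}=x(x-\lambda)\cdots(x-(n-1)\lambda)$ for $n\ge1$. The degenerate exponential is $e_\lambda^{x}(t)=(1+\lambda t)^{x/\lambda}=\sum_{n\ge0}(x)_{n,\lambda}\frac{t^n}{n!}$, and $e_\lambda(t)=e_\lambda^1(t)$. The degenerate $r$-Stirling numbers of the second kind are defined by $\frac{1}{k!}(e_\lambda(t)-1)^k e_\lambda^{r}(t)=\sum_{n\ge k}{n+r\brace k+r}_{r,\lambda}\frac{t^n}{n!}$ for $k\ge0$. For real $x,y$ with $1+\lambda x>0$, the fully degenerate $r$-Bell polynomials $B^{(r)}_{n,\lambda}(x)$ and the two variable fully degenerate $r$-Bell polynomials $B^{(r)}_{n,\lambda}(x,y)$ are defined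 by the formal power series identities in $t$ \[ \frac{e_\lambda(xe_\lambda(t))\,e_\lambda^r(t)}{e_\lambda(x)}=\sum_{n\ge0}B^{(r)}_{n,\lambda}(x)\frac{t^n}{n!},\qquad \frac{e^y_\lambda(xe_\lambda(t))\,e_\lambda^r(t)}{e_\lambda(x)}=\sum_{n\ge0}B^{(r)}_{n,\lambda}(x,y)\frac{t^n}{n!}, \] where $e_\lambda^{y}(xe_\lambda(t))=(1+\lambda x e_\lambda(t))^{y/\lambda}$ and $e_\lambda(x)=(1+\lambda x)^{1/\lambda}$. *)

theory Defs
  imports Complex_Main "HOL-Computational_Algebra.Formal_Power_Series"
begin

definition deg_ffact :: "real \<Rightarrow> real \<Rightarrow> nat \<Rightarrow> real" where
  "deg_ffact lam x n = (\<Prod>i<n. x - real i * lam)"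

text \<open>Real power of a formal power series \<open>F\<close> with constant term \<open>c > 0\<close>:
  \<open>F\<^sup>a = c\<^sup>a (1 + (F / c - 1))\<^sup>a\<close>, where \<open>(1 + z)\<^sup>a\<close> is the binomial series and \<open>F / c - 1\<close> has
  constant term zero.  It is only meaningful for a positive constant term.\<close>

definition fps_real_power :: "real fps \<Rightarrow> real \<Rightarrow> real fps" where
  "fps_real_power F a =
     fps_const (fps_nth F 0 powr a) *
     fps_compose (fps_binomial a) (F / fps_const (fps_nth F 0) - 1)"

definition deg_exp :: "real \<Rightarrow> real \<Rightarrow> real \<Rightarrow> real" where
  "deg_exp lam y x = (1 + lam * x) powr (y / lam)"

definition deg_exp_fps :: "real \<Rightarrow> real \<Rightarrow> real fps" where
  "deg_exp_fps lam x = Abs_fps (\<lambda>n. deg_ffact lam x n / fact n)"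

definition deg_exp_comp :: "real \<Rightarrow> real \<Rightarrow> real fps \<Rightarrow> real fps" where
  "deg_exp_comp lam y F = fps_real_power (1 + fps_const lam * F) (y / lam)"

text \<open>The series and the power form of the degenerate exponential agree.\<close>

lemma deg_exp_comp_X:
  assumes "lam \<noteq> 0"
  shows "deg_exp_comp lam x fps_X = deg_exp_fps lam x"
proof (rule fps_ext)
  fix n
  have "(x / lam gchoose n) * lam ^ n = (\<Prod>i<n. (x / lam - real i) * lam) / fact n"
    by (simp add: gbinomial_prod_rev prod.distrib atLeast0LessThan)
  also have "(\<Prod>i<n. (x / lam - real i) * lam) = deg_ffact lam x n"
    unfolding deg_ffact_def using assms by (intro prod.cong) (auto simp: field_simps)
  finally have *: "(x / lam gchoose n) * lam ^ n = deg_ffact lam x n / fact n" .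
  show "fps_nth (deg_exp_comp lam x fps_X) n = fps_nth (deg_exp_fps lam x) n"
    using * by (simp add: deg_exp_comp_def fps_real_power_def deg_exp_fps_def mult.commute[of "_ gchoose _"])
qed

text \<open>\<open>deg_r_stirling lam r n k\<close> has the shift by \<open>r\<close> built in: it is the number written with upper
  entry \<open>n + r\<close>, lower entry \<open>k + r\<close> and subscript \<open>r, lam\<close>.\<close>

definition deg_r_stirling :: "real \<Rightarrow> nat \<Rightarrow> nat \<Rightarrow> nat \<Rightarrow> real" where
  "deg_r_stirling lam r n k =
     fact n * fps_nth
       (fps_const (1 / fact k) * (deg_exp_fps lam 1 - 1) ^ k * deg_exp_fps lam (real r)) n"

lemma deg_r_stirling_eq_0:
  assumes "n < k"
  shows "deg_r_stirling lam r n k = 0"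
proof -
  have "fps_nth (deg_exp_fps lam 1 - 1) 0 = 0"
    by (simp add: deg_exp_fps_def deg_ffact_def)
  hence "fps_nth ((deg_exp_fps lam 1 - 1) ^ k) i = 0" if "i < k" for i
    using startsby_zero_power_prefix that by blast
  hence "fps_nth ((deg_exp_fps lam 1 - 1) ^ k * deg_exp_fps lam (real r)) n = 0"
    using assms by (auto simp: fps_mult_nth intro!: sum.neutral)
  thus ?thesis
    by (simp add: deg_r_stirling_def mult.assoc)
qed

definition fd_r_bell :: "real \<Rightarrow> nat \<Rightarrow> nat \<Rightarrow> real \<Rightarrow> real" where
  "fd_r_bell lam r n x =
     fact n * fps_nth
       (deg_exp_comp lam 1 (fps_const x * deg_exp_fps lam 1) * deg_exp_fps lam (real r)
          / fps_const (deg_exp lam 1 x)) n"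

text \<open>The normalising constant is \<open>deg_exp lam 1 x\<close>, not \<open>deg_exp lam y x\<close>.\<close>

definition fd_r_bell2 :: "real \<Rightarrow> nat \<Rightarrow> nat \<Rightarrow> real \<Rightarrow> real \<Rightarrow> real" where
  "fd_r_bell2 lam r n x y =
     fact n * fps_nth
       (deg_exp_comp lam y (fps_const x * deg_exp_fps lam 1) * deg_exp_fps lam (real r)
          / fps_const (deg_exp lam 1 x)) n"

end

theory Submission
  imports Defs
begin

unbundle fps_syntax

text \<open>Write \<open>E\<^sub>a = (1 + lam t)\<^bsup>a/lam\<^esup>\<close> and \<open>G\<^sub>y = (1 + lam x E\<^sub>1)\<^bsup>y/lam\<^esup>\<close>, and let \<open>S m k\<close> be the degenerate
  \<open>r\<close>-Stirling numbers and \<open>(y)\<^sub>k\<close> the degenerate falling factorials.  From \<open>E\<^sub>a' = a E\<^bsub>a-lam\<^esub>\<close>,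
  \<open>G\<^sub>y' = y x E\<^bsub>1-lam\<^esub> G\<^bsub>y-lam\<^esub>\<close> and \<open>E\<^sub>a E\<^sub>b = E\<^bsub>a+b\<^esub>\<close>, together with the recurrence
  \<open>S (m+1) k = (k + r - m lam) S m k + S m (k-1)\<close>, induction on \<open>m\<close> shows that the \<open>m\<close>-th derivative
  of \<open>G\<^sub>y E\<^sub>r\<close> is \<open>\<Sum>k\<le>m. S m k (y)\<^sub>k x\<^sup>k E\<^bsub>k - m lam\<^esub> G\<^bsub>y - k lam\<^esub> E\<^sub>r\<close>.  Comparing the coefficients
  of \<open>t\<^sup>n / n!\<close> gives the theorem.\<close>

section \<open>Calculus of real powers of power series\<close>

lemma fps_deriv_binomial:
  "fps_deriv (fps_binomial a) = fps_const (a :: 'a :: field_char_0) * fps_binomial (a - 1)"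
proof (rule fps_ext)
  fix n
  show "fps_deriv (fps_binomial a) $ n = (fps_const a * fps_binomial (a - 1)) $ n"
    using gbinomial_absorption[of n a] by simp
qed

text \<open>Positivity of the constant term \<open>c\<close> makes \<open>F / c - 1\<close> start at
  zero, so composing with it is multiplicative and the exponent law of the binomial series carries
  over.\<close>

lemma fps_real_power_add:
  assumes "F $ 0 > 0"
  shows "fps_real_power F (a + b) = fps_real_power F a * fps_real_power F b"
proof -
  have "(F / fps_const (F $ 0) - 1) $ 0 = 0"
    using assms by (simp add: fps_divide_unit fps_const_inverse)
  then show ?thesis
    using assms
    by (simp add: fps_real_power_def fps_binomial_add_mult fps_compose_mult_distrib powr_add
        flip: fps_const_mult)
qed

lemma fps_deriv_real_power:
  assumes "F $ 0 > 0"
  shows "fps_deriv (fps_real_power F a) =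
    fps_const a * fps_deriv F * fps_real_power F (a - 1)"
proof -
  define c where "c = F $ 0"
  define H where "H = F / fps_const c - 1"
  have c: "c > 0" using assms by (simp add: c_def)
  have H: "H = fps_const (inverse c) * F - 1"
    using c by (simp add: H_def fps_divide_unit fps_const_inverse)
  have H0: "H $ 0 = 0" using c by (simp add: H c_def)
  \<comment> \<open>The chain rule leaves a factor \<open>1 / c\<close>, which lowers the exponent
    of the leading constant by one.\<close>
  have "fps_const (c powr a) * fps_const (inverse c) = fps_const (c powr (a - 1))"
    using c by (simp add: powr_diff field_simps)
  moreover have "fps_deriv (fps_binomial a oo H) =
      fps_const a * (fps_binomial (a - 1) oo H) * (fps_const (inverse c) * fps_deriv F)"
    using H0 by (simp add: fps_compose_deriv fps_deriv_binomial fps_compose_mult_distrib H)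
  moreover have "fps_real_power F b = fps_const (c powr b) * (fps_binomial b oo H)" for b
    by (simp add: fps_real_power_def c_def H_def)
  ultimately show ?thesis
    by (simp add: mult_ac)
qed

section \<open>Degenerate falling factorials and exponentials\<close>

lemma deg_ffact_0 [simp]: "deg_ffact lam x 0 = 1"
  by (simp add: deg_ffact_def)

lemma deg_ffact_Suc: "deg_ffact lam x (Suc n) = deg_ffact lam x n * (x - real n * lam)"
  by (simp add: deg_ffact_def)

lemma deg_ffact_Suc_shift: "deg_ffact lam x (Suc n) = x * deg_ffact lam (x - lam) n"
  unfolding deg_ffact_def by (subst prod.lessThan_Suc_shift) (simp add: algebra_simps)

lemma deg_exp_fps_nth_0 [simp]: "deg_exp_fps lam a $ 0 = 1"
  by (simp add: deg_exp_fps_def)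

lemma deg_exp_fps_0: "deg_exp_fps lam 0 = 1"
proof (rule fps_ext)
  fix n
  show "deg_exp_fps lam 0 $ n = 1 $ n"
    by (cases n) (simp_all add: deg_exp_fps_def deg_ffact_Suc_shift)
qed

text \<open>Read as real powers of \<open>1 + lam t\<close>, the two factors have exponents
  \<open>a / lam\<close> and \<open>b / lam\<close>, which add.\<close>

lemma deg_exp_fps_add:
  assumes "lam \<noteq> 0"
  shows "deg_exp_fps lam (a + b) = deg_exp_fps lam a * deg_exp_fps lam b"
  using fps_real_power_add[of "1 + fps_const lam * fps_X" "a / lam" "b / lam"] assms
  by (simp add: deg_exp_comp_def add_divide_distrib flip: deg_exp_comp_X)

lemma fps_deriv_deg_exp_fps:
  "fps_deriv (deg_exp_fps lam a) = fps_const a * deg_exp_fps lam (a - lam)"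
proof (rule fps_ext)
  fix n
  show "fps_deriv (deg_exp_fps lam a) $ n = (fps_const a * deg_exp_fps lam (a - lam)) $ n"
    by (simp add: deg_exp_fps_def deg_ffact_Suc_shift del: of_nat_Suc)
qed

lemma deg_exp_fps_self: "deg_exp_fps lam lam = 1 + fps_const lam * fps_X"
proof (rule fps_ext)
  fix n
  show "deg_exp_fps lam lam $ n = (1 + fps_const lam * fps_X) $ n"
  proof (cases n)
    case (Suc k)
    then show ?thesis
      by (cases k) (simp_all add: deg_exp_fps_def deg_ffact_Suc_shift)
  qed simp
qed

lemma fps_deriv_deg_exp_comp:
  assumes "lam \<noteq> 0" "1 + lam * F $ 0 > 0"
  shows "fps_deriv (deg_exp_comp lam y F) =
    fps_const y * fps_deriv F * deg_exp_comp lam (y - lam) F"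
proof -
  have "fps_deriv (deg_exp_comp lam y F) =
      fps_const (y / lam) * fps_const lam * fps_deriv F * deg_exp_comp lam (y - lam) F"
    using fps_deriv_real_power[of "1 + fps_const lam * F" "y / lam"] assms
    by (simp add: deg_exp_comp_def diff_divide_distrib mult.assoc del: fps_const_mult)
  then show ?thesis using assms by simp
qed

section \<open>Degenerate r-Stirling numbers\<close>

lemma deg_r_stirling_0: "deg_r_stirling lam r 0 k = (if k = 0 then 1 else 0)"
  by (simp add: deg_r_stirling_eq_0) (simp add: deg_r_stirling_def)

text \<open>Multiplying by \<open>E lam = 1 + lam t\<close> undoes the shift by \<open>- lam\<close> that differentiation introduces.\<close>

lemma deg_r_stirling_Suc:
  assumes "lam \<noteq> 0"
  shows "deg_r_stirling lam r (Suc n) k =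
    (real k + real r - real n * lam) * deg_r_stirling lam r n k
    + (if k = 0 then 0 else deg_r_stirling lam r n (k - 1))"
proof -
  define E where "E = deg_exp_fps lam"
  \<comment> \<open>\<open>F k\<close> is the generating function of column \<open>k\<close>;
    \<open>P\<close> is the column before it, or zero if there is none.\<close>
  define F where "F = (\<lambda>k. fps_const (1 / fact k) * (E 1 - 1) ^ k * E (real r))"
  define P where "P = (if k = 0 then 0 else F (k - 1))"
  have E: "E lam * E (a - lam) = E a" for a
    using deg_exp_fps_add[OF assms, of lam "a - lam"] by (simp add: E_def)
  have dE: "E lam * fps_deriv (E a) = fps_const a * E a" for a
    using E[of a] by (simp add: E_def fps_deriv_deg_exp_fps mult.left_commute)
  have S: "deg_r_stirling lam r i j = fact i * F j $ i" for i j
    by (simp add: deg_r_stirling_def F_def E_def)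
  have "E lam * fps_deriv (F k) = fps_const (real k + real r) * F k + P"
  proof (cases k)
    case 0
    then show ?thesis using dE[of "real r"] by (simp add: F_def P_def)
  next
    case (Suc j)
    have c: "fps_const (1 / fact k) * fps_const (real k) = fps_const (1 / fact j :: real)"
      by (simp add: Suc del: of_nat_Suc)
    have dk: "fps_deriv ((E 1 - 1) ^ k) = fps_const (real k) * fps_deriv (E 1) * (E 1 - 1) ^ j"
      by (simp add: fps_deriv_power Suc del: power_Suc of_nat_Suc)
    have "E lam * fps_deriv (F k) =
        (fps_const (1 / fact k) * fps_const (real k)) * (E 1 - 1) ^ j
          * (E lam * fps_deriv (E 1)) * E (real r)
        + fps_const (1 / fact k) * (E 1 - 1) ^ k * (E lam * fps_deriv (E (real r)))"
      unfolding F_def fps_deriv_mult fps_deriv_const dk by algebra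
    also have "\<dots> = fps_const (1 / fact j) * (E 1 - 1) ^ j * E 1 * E (real r)
        + fps_const (real r) * F k"
      unfolding c dE F_def fps_const_1_eq_1 by algebra
    \<comment> \<open>Splitting \<open>E 1\<close> as \<open>(E 1 - 1) + 1\<close> restores the
      power \<open>k\<close> in one summand and leaves the previous column in the other.\<close>
    also have "fps_const (1 / fact j) * (E 1 - 1) ^ j * E 1 * E (real r) =
        fps_const (1 / fact j) * (E 1 - 1) ^ k * E (real r) + F j"
      unfolding F_def Suc power_Suc by algebra
    also have "fps_const (1 / fact j) * (E 1 - 1) ^ k * E (real r) = fps_const (real k) * F k"
      unfolding F_def c[symmetric] by algebra
    finally show ?thesis
      by (simp add: P_def Suc distrib_right flip: fps_const_add)
  qed
  then have "(E lam * fps_deriv (F k)) $ n = (fps_const (real k + real r) * F k + P) $ n"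
    by simp
  \<comment> \<open>The summand \<open>lam t\<close> of \<open>E lam\<close> yields
    \<open>lam * n\<close>, the source of \<open>- n lam\<close> in the recurrence.\<close>
  moreover have "(E lam * fps_deriv (F k)) $ n = real (Suc n) * F k $ Suc n + lam * real n * F k $ n"
    by (cases n) (simp_all add: E_def deg_exp_fps_self ring_distribs mult.assoc)
  ultimately have "real (Suc n) * F k $ Suc n = (real k + real r - real n * lam) * F k $ n + P $ n"
    by (simp add: algebra_simps)
  then have "fact n * (real (Suc n) * F k $ Suc n) =
      fact n * ((real k + real r - real n * lam) * F k $ n + P $ n)"
    by simp
  then show ?thesis
    unfolding S P_def by (cases "k = 0") (simp_all add: algebra_simps)
qed

lemma fps_nth_deriv_deg_exp_comp_mult:
  fixes lam x y :: real and r m :: nat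
  defines "G \<equiv> \<lambda>y. deg_exp_comp lam y (fps_const x * deg_exp_fps lam 1)"
  assumes "lam \<noteq> 0" "1 + lam * x > 0"
  shows "fps_nth_deriv m (G y * deg_exp_fps lam (real r)) =
    (\<Sum>k\<le>m. fps_const (deg_r_stirling lam r m k * deg_ffact lam y k * x ^ k)
       * (deg_exp_fps lam (real k - real m * lam)
          * (G (y - real k * lam) * deg_exp_fps lam (real r))))"
proof (induction m)
  case 0
  then show ?case by (simp add: deg_r_stirling_0 deg_exp_fps_0)
next
  case (Suc m)
  define E where "E = deg_exp_fps lam"
  define T where "T = (\<lambda>k. E (real k + real r - real (Suc m) * lam) * G (y - real k * lam))"
  define c where "c = (\<lambda>k. deg_ffact lam y k * x ^ k)"
  define S where "S = deg_r_stirling lam r"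
  have E: "E a * E b = E (a + b)" for a b
    using deg_exp_fps_add[OF assms(2)] by (simp add: E_def)
  have EG: "E (real k - real i * lam) * (G z * E (real r)) =
      E (real k + real r - real i * lam) * G z" for k i z
    using E[of "real k - real i * lam" "real r"] by (simp add: algebra_simps)
  have dG: "fps_deriv (G z) = fps_const (z * x) * E (1 - lam) * G (z - lam)" for z
    using fps_deriv_deg_exp_comp[of lam "fps_const x * deg_exp_fps lam 1" z] assms
    by (simp add: G_def E_def fps_deriv_deg_exp_fps mult.assoc flip: fps_const_mult)
  \<comment> \<open>Differentiating the \<open>E\<close> factor keeps \<open>k\<close>;
    differentiating the \<open>G\<close> factor contributes \<open>E (1 - lam)\<close> and moves to
    \<open>k + 1\<close>. Both raise \<open>m\<close> by one in the exponent of
    \<open>E\<close>.\<close>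
  have step: "fps_deriv (fps_const (S m k * c k) * (E (real k + real r - real m * lam) * G (y - real k * lam)))
      = fps_const ((real k + real r - real m * lam) * S m k * c k) * T k
        + fps_const (S m k * c (Suc k)) * T (Suc k)" for k
  proof -
    have "fps_deriv (E (real k + real r - real m * lam) * G (y - real k * lam)) =
      fps_const (real k + real r - real m * lam) * T k
      + fps_const ((y - real k * lam) * x) * T (Suc k)"
      using E[of "real k + real r - real m * lam" "1 - lam"]
      by (simp add: dG fps_deriv_deg_exp_fps[of lam, folded E_def] T_def algebra_simps
          del: fps_const_mult fps_const_add fps_const_sub)
    moreover have "c (Suc k) = (y - real k * lam) * x * c k"
      by (simp add: c_def deg_ffact_Suc)
    ultimately show ?thesis
      by (simp only: fps_deriv_mult_const_left fps_const_mult[symmetric] distrib_left mult_ac)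
  qed
  have "fps_nth_deriv (Suc m) (G y * E (real r)) = fps_deriv (fps_nth_deriv m (G y * E (real r)))"
    by (rule fps_nth_deriv_commute)
  also have "\<dots> = fps_deriv (\<Sum>k\<le>m. fps_const (S m k * c k)
      * (E (real k + real r - real m * lam) * G (y - real k * lam)))"
    by (simp only: Suc.IH[folded E_def] EG S_def c_def mult.assoc)
  also have "\<dots> = (\<Sum>k\<le>m. fps_const ((real k + real r - real m * lam) * S m k * c k) * T k)
      + (\<Sum>k\<le>m. fps_const (S m k * c (Suc k)) * T (Suc k))"
    by (simp only: fps_deriv_sum step sum.distrib)
  \<comment> \<open>The added term vanishes because \<open>S m (Suc m) = 0\<close>; below, the index
    shift adds a zero term at \<open>k = 0\<close>. Both sums then match the recurrence.\<close>
  also have "(\<Sum>k\<le>m. fps_const ((real k + real r - real m * lam) * S m k * c k) * T k) =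
      (\<Sum>k\<le>Suc m. fps_const ((real k + real r - real m * lam) * S m k * c k) * T k)"
    by (simp add: S_def deg_r_stirling_eq_0)
  also have "(\<Sum>k\<le>m. fps_const (S m k * c (Suc k)) * T (Suc k)) =
      (\<Sum>k\<le>Suc m. fps_const ((if k = 0 then 0 else S m (k - 1)) * c k) * T k)"
    by (subst sum.atMost_Suc_shift) simp
  also have "(\<Sum>k\<le>Suc m. fps_const ((real k + real r - real m * lam) * S m k * c k) * T k) + \<dots>
      = (\<Sum>k\<le>Suc m. fps_const (S (Suc m) k * c k) * T k)"
    unfolding S_def deg_r_stirling_Suc[OF assms(2)] sum.distrib[symmetric]
    by (intro sum.cong refl)
      (simp only: distrib_right[symmetric] fps_const_add)
  finally show ?case
    by (simp only: E_def[symmetric] EG S_def c_def T_def mult.assoc)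
qed

section \<open>Comparison of coefficients\<close>

lemma fps_nth_fps_nth_deriv:
  "fact n * fps_nth_deriv m F $ n = fact (n + m) * (F $ (n + m) :: 'a :: field_char_0)"
proof (induction m arbitrary: F)
  case (Suc m)
  then show ?case by (simp add: algebra_simps)
qed simp

lemma fd_r_bell2_alt:
  assumes "1 + lam * x > 0"
  shows "fd_r_bell2 lam r n x y = fact n *
     (deg_exp_comp lam y (fps_const x * deg_exp_fps lam 1) * deg_exp_fps lam (real r)) $ n
     / deg_exp lam 1 x"
proof -
  have "deg_exp lam 1 x \<noteq> 0" using assms by (simp add: deg_exp_def)
  then have "F / fps_const (deg_exp lam 1 x) = F * fps_const (inverse (deg_exp lam 1 x))" for F
    by (simp add: fps_divide_unit fps_const_inverse)
  then show ?thesis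
    by (simp only: fd_r_bell2_def fps_mult_right_const_nth divide_inverse mult.assoc[of "fact n"])
qed

lemma fd_r_bell2_add:
  fixes lam x y :: real and r m n :: nat
  assumes "lam \<noteq> 0" and "1 + lam * x > 0"
  shows "fd_r_bell2 lam r (n + m) x y =
      (\<Sum>k=0..m. \<Sum>l=0..n. real (n choose l) * deg_r_stirling lam r m k
         * deg_ffact lam (real k - real m * lam) (n - l) * deg_ffact lam y k * x ^ k
         * fd_r_bell2 lam r l x (y - real k * lam))"
proof -
  define W where "W = (\<lambda>y. deg_exp_comp lam y (fps_const x * deg_exp_fps lam 1)
    * deg_exp_fps lam (real r))"
  define d where "d = deg_exp lam 1 x"
  define C where "C = (\<lambda>k. deg_r_stirling lam r m k * deg_ffact lam y k * x ^ k)"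
  \<comment> \<open>The divisor \<open>d\<close> does not depend on \<open>z\<close>, so an identity
    between the numerators suffices.\<close>
  have B: "fd_r_bell2 lam r i x z = fact i * W z $ i / d" for i z
    by (simp add: fd_r_bell2_alt[OF assms(2)] W_def d_def)
  have conv: "fact n * (deg_exp_fps lam a * W z) $ n =
      (\<Sum>l=0..n. real (n choose l) * deg_ffact lam a (n - l) * (fact l * W z $ l))" for a z
  proof -
    \<comment> \<open>With \<open>W z\<close> as the left factor, the Cauchy product index
      \<open>l\<close> falls on \<open>W z\<close>, as required.\<close>
    have "fact n * (W z * deg_exp_fps lam a) $ n =
      (\<Sum>l=0..n. real (n choose l) * deg_ffact lam a (n - l) * (fact l * W z $ l))"
      unfolding fps_mult_nth sum_distrib_left
      by (intro sum.cong refl) (simp add: binomial_fact deg_exp_fps_def)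
    then show ?thesis by (simp add: mult.commute)
  qed
  have "fact (n + m) * W y $ (n + m) = fact n * fps_nth_deriv m (W y) $ n"
    by (simp add: fps_nth_fps_nth_deriv)
  also have "\<dots> = (\<Sum>k\<le>m. C k * (fact n * (deg_exp_fps lam (real k - real m * lam)
      * W (y - real k * lam)) $ n))"
    unfolding W_def fps_nth_deriv_deg_exp_comp_mult[OF assms]
    unfolding fps_sum_nth sum_distrib_left C_def fps_mult_left_const_nth
    by (simp only: mult_ac)
  finally have "fd_r_bell2 lam r (n + m) x y = (\<Sum>k\<le>m. C k * (fact n *
      (deg_exp_fps lam (real k - real m * lam) * W (y - real k * lam)) $ n)) / d"
    unfolding B by (rule arg_cong)
  also have "\<dots> = (\<Sum>k=0..m. \<Sum>l=0..n. real (n choose l) * deg_r_stirling lam r m k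
         * deg_ffact lam (real k - real m * lam) (n - l) * deg_ffact lam y k * x ^ k
         * fd_r_bell2 lam r l x (y - real k * lam))"
    unfolding conv B sum_distrib_left sum_divide_distrib atMost_atLeast0
    by (intro sum.cong refl) (simp add: C_def)
  finally show ?thesis .
qed

lemma fd_r_bell_eq_fd_r_bell2: "fd_r_bell lam r n x = fd_r_bell2 lam r n x 1"
  by (simp add: fd_r_bell_def fd_r_bell2_def)

theorem theorem2p15:
  fixes lam x y :: real and r m n :: nat
  assumes "lam \<noteq> 0" and "1 + lam * x > 0"
  shows "fd_r_bell2 lam r (n + m) x y =
      (\<Sum>k=0..m. \<Sum>l=0..n. real (n choose l) * deg_r_stirling lam r m k
         * deg_ffact lam (real k - real m * lam) (n - l) * deg_ffact lam y k * x ^ k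
         * fd_r_bell2 lam r l x (y - real k * lam))
    \<and> fd_r_bell lam r (n + m) x =
      (\<Sum>k=0..m. \<Sum>l=0..n. real (n choose l) * deg_r_stirling lam r m k
         * deg_ffact lam (real k - real m * lam) (n - l) * deg_ffact lam 1 k * x ^ k
         * fd_r_bell2 lam r l x (1 - real k * lam))"
  unfolding fd_r_bell_eq_fd_r_bell2 using fd_r_bell2_add[OF assms] by blast

end
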